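(* For every $a$ with $1<a\leq 2$ there exist real numbers $N_a^1>0$, $N_a^2>0$ and $\delta_1>0$, $\delta_2>0$ such that the lines $\gamma_1:(-\delta_1,\delta_1)\to\mathbb{R}^2_{>1^+}$, $\gamma_1(t)=(a+N_a^1 t,\,-t)$, and $\gamma_2:(-\delta_2,\delta_2)\to\mathbb{R}^2_{>1^+}$, $\gamma_2(t)=(a+N_a^2 t,\,t)$, are well defined (i.e. take values in $\mathbb{R}^2_{>1^+}$), and the topological entropies $h_{top}(\mathcal{L}_{\gamma_1(t)})$ and $h_{top}(\mathcal{L}_{\gamma_2(t)})$ are non-decreasing functions of $t$ on $(-\delta_1,\delta_1)$ and $(-\delta_2,\delta_2)$, respectively.
   Context: $\mathbb{R}^2_{>1^+}=\{(a,b)\in\mathbb{R}^2 : a>1+|b|\}$. For $a,b\in\mathbb{R}$ the Lozi map is $\mathcal{L}_{a,b}:\mathbb{R}^2\to\mathbb{R}^2$, $\mathcal{L}_{a,b}(x,y)=(1-a|x|+by,\;x)$ (for $b=0$, which occurs at $t=0$, the same formula is used). Since $\mathbb{R}^2$ is not compact, $h_{top}(\mathcal{L}_{a,b})$ is understood as the supremum of the (usual) topological entropies of the restrictions $\mathcal{L}_{a,b}|_C$ over all compact sets $C\subset\mathbb{R}^2$ with $\mathcal{L}_{a,b}(C)=C$ (and $0$ if there is no nonempty such $C$). "Non-decreasing" is in the weak sense. *)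

theory Defs
  imports "HOL-Analysis.Analysis"
begin

text \<open>Topological entropy in the Bowen--Dinaburg form, via \<open>(n,\<epsilon>)\<close>-separated sets.\<close>

definition separated_orbits ::
    "('a::metric_space \<Rightarrow> 'a) \<Rightarrow> nat \<Rightarrow> real \<Rightarrow> 'a set \<Rightarrow> bool" where
  "separated_orbits f n \<epsilon> E \<longleftrightarrow>
     (\<forall>x\<in>E. \<forall>y\<in>E. x \<noteq> y \<longrightarrow> (\<exists>i<n. \<epsilon> < dist ((f ^^ i) x) ((f ^^ i) y)))"

text \<open>
  The logarithm of the maximal cardinality of an \<open>(n,\<epsilon>)\<close>-separated subset of \<open>C\<close>. The supremum
  ranges over finite sets because \<open>card\<close> vanishes on infinite ones; if there are arbitrarily
  large separated sets, the value is \<open>\<infinity>\<close>. The empty set contributes \<open>ln 0 = 0\<close>, which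
  for nonempty \<open>C\<close> is also attained by singletons.
\<close>

definition log_max_separated ::
    "('a::metric_space \<Rightarrow> 'a) \<Rightarrow> 'a set \<Rightarrow> nat \<Rightarrow> real \<Rightarrow> ereal" where
  "log_max_separated f C n \<epsilon> =
     (SUP E\<in>{E. E \<subseteq> C \<and> finite E \<and> separated_orbits f n \<epsilon> E}. ereal (ln (real (card E))))"

text \<open>
  Entropy of the restriction of \<open>f\<close> to a compact set \<open>C\<close> with \<open>f ` C = C\<close>; the limit as
  \<open>\<epsilon>\<close> tends to \<open>0\<close> is a supremum, since the growth rate increases as \<open>\<epsilon>\<close> decreases.
\<close>

definition entropy_on :: "('a::metric_space \<Rightarrow> 'a) \<Rightarrow> 'a set \<Rightarrow> ereal" where
  "entropy_on f C =
     (SUP \<epsilon>\<in>{0<..}. limsup (\<lambda>n. log_max_separated f C n \<epsilon> / ereal (real n)))"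

text \<open>
  The inserted \<open>0\<close> fixes the value when there is no nonempty compact invariant set (the
  supremum of the empty set of extended reals is \<open>-\<infinity>\<close>); otherwise it has no effect, since
  each \<open>entropy_on f C\<close> is nonnegative.
\<close>

definition h_top :: "('a::metric_space \<Rightarrow> 'a) \<Rightarrow> ereal" where
  "h_top f = Sup (insert 0 {entropy_on f C |C. compact C \<and> C \<noteq> {} \<and> f ` C = C})"

fun lozi :: "real \<times> real \<Rightarrow> real \<times> real \<Rightarrow> real \<times> real" where
  "lozi (a, b) (x, y) = (1 - a * \<bar>x\<bar> + b * y, x)"

definition lozi_params :: "(real \<times> real) set" where
  "lozi_params = {(a, b). a > 1 + \<bar>b\<bar>}"

end

theory Submission
  imports Defs
begin

text \<open>
  For \<open>a > 1 + \<bar>b\<bar>\<close> a bounded bi-infinite orbit of \<open>lozi (a, b)\<close> is determined by its sequence of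
  signs \<open>s\<close>: the equations \<open>x (n + 1) = 1 - a * s n * x n + b * x (n - 1)\<close> have a unique bounded
  solution for every \<open>s\<close>, by contraction, and it is an orbit iff \<open>s n * x n \<ge> 0\<close> for all \<open>n\<close>. Follow
  this solution along a line with \<open>N\<close> large and \<open>t\<close> small. Where \<open>x n\<close> is not close to \<open>0\<close> its sign
  cannot change. Where it is close to \<open>0\<close>, the point \<open>x (n + 1)\<close> is close to the critical value \<open>1\<close>,
  and transversality of the critical orbit of the tent map of slope \<open>a\<close> shows that \<open>s n * x n\<close>
  increases with \<open>t\<close>. So for \<open>t < t'\<close> every orbit at \<open>t\<close> continues to an orbit at \<open>t'\<close> with the same
  signs, whose points moreover stay uniformly away from \<open>0\<close>. Hence orbits at \<open>t\<close> that are \<open>\<epsilon>\<close>-apart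
  within time \<open>n\<close> differ in a sign within a slightly larger window, and their continuations are
  \<open>\<kappa>\<close>-apart there; this compares the entropies.
\<close>

section \<open>Transversality for the tent map\<close>

text \<open>Feeding the supremum S of all \<open>\<bar>u j\<bar>\<close> into
  \<open>contract\<close> yields S \<le> \<alpha> + \<theta> * S. The a priori bound serves to make
  S finite and does not enter the result.\<close>

lemma sup_contraction_bound:
  fixes u :: "'i \<Rightarrow> real"
  assumes bounded: "\<And>i. \<bar>u i\<bar> \<le> B" and \<theta>: "\<theta> < 1"
    and contract: "\<And>B i. (\<And>j. \<bar>u j\<bar> \<le> B) \<Longrightarrow> \<bar>u i\<bar> \<le> \<alpha> + \<theta> * B"
  shows "\<bar>u i\<bar> \<le> \<alpha> / (1 - \<theta>)"
proof -
  define S where "S = (SUP j. \<bar>u j\<bar>)"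
  have "bdd_above (range (\<lambda>j. \<bar>u j\<bar>))"
    using bounded by (auto simp: bdd_above_def)
  then have S: "\<bar>u j\<bar> \<le> S" for j
    unfolding S_def by (auto intro: cSUP_upper)
  have "S \<le> \<alpha> + \<theta> * S"
    unfolding S_def by (rule cSUP_least) (use contract[OF S] in \<open>auto simp: S_def\<close>)
  then have "S \<le> \<alpha> / (1 - \<theta>)"
    using \<theta> by (simp add: field_simps)
  with S[of i] show ?thesis by simp
qed

text \<open>
  Here \<open>D n\<close> is the derivative with respect to \<open>a\<close> of the point whose itinerary is
  \<open>s n, s (n + 1), \<dots>\<close>, kept fixed. Unrolling the recursion twice suffices for slopes above
  \<open>3/2\<close>, four times for slopes between \<open>7/5 < \<surd>2\<close> and \<open>3/2\<close>.
\<close>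

lemma tent_transversality_large_slope:
  fixes x s D :: "nat \<Rightarrow> real"
  assumes a: "7/5 \<le> a" "a \<le> 2"
    and x0: "x 0 = 1" and x: "\<And>n. x (Suc n) = 1 - a * \<bar>x n\<bar>"
    and s: "\<And>n. s n = 1 \<or> s n = -1" and sx: "\<And>n. s n * x n = \<bar>x n\<bar>"
    and D: "\<And>n. D (Suc n) = - a * s n * D n - \<bar>x n\<bar>" and bounded: "\<And>n. \<bar>D n\<bar> \<le> K"
  shows "D 0 < 0"
proof (rule ccontr)
  assume "\<not> D 0 < 0"
  then have D0: "D 0 \<ge> 0" by simp
  have x_le: "\<bar>x n\<bar> \<le> 1" for n
  proof (induction n)
    case (Suc n)
    have "a * \<bar>x n\<bar> \<le> 2 * 1"
      by (rule mult_mono) (use Suc a in auto)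
    moreover have "0 \<le> a * \<bar>x n\<bar>" using a by simp
    ultimately show ?case unfolding x by linarith
  qed (simp add: x0)
  \<comment> \<open>The recursion expands by the factor a, so solved for \<open>D i\<close> it
    contracts by 1 / a, and a bounded solution is at most 1 / (a - 1) in size. The cases below show
    that \<open>D 0 \<ge> 0\<close> violates this at index 2 or 4.\<close>
  have D_le: "\<bar>D n\<bar> \<le> (1 / a) / (1 - 1 / a)" for n
  proof (rule sup_contraction_bound[OF bounded])
    fix B i assume B: "\<And>j. \<bar>D j\<bar> \<le> B"
    have "a * \<bar>D i\<bar> = \<bar>D (Suc i) + \<bar>x i\<bar>\<bar>"
      unfolding D using s[of i] a by (auto simp: abs_mult)
    also have "\<dots> \<le> B + 1" using B[of "Suc i"] x_le[of i] by linarith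
    finally show "\<bar>D i\<bar> \<le> 1 / a + 1 / a * B" using a by (simp add: field_simps)
  qed (use a in simp)
  have D_le: "\<bar>D n\<bar> * (a - 1) \<le> 1" for n
    using D_le[of n] a by (simp add: field_simps)
  have s_pos: "s n = 1" if "x n > 0" for n using s[of n] sx[of n] that by auto
  have x1: "x 1 = 1 - a" using x[of 0] x0 by simp
  have s1: "s 1 = -1" using s[of 1] sx[of 1] x1 a by auto
  have D1: "D 1 = - a * D 0 - 1" using D[of 0] s_pos[of 0] x0 by simp
  have D2: "D 2 = - a\<^sup>2 * D 0 - 2 * a + 1"
  proof -
    have "D 2 = - a * s 1 * D 1 - \<bar>x 1\<bar>" using D[of 1] by (simp add: numeral_2_eq_2)
    also have "\<dots> = - a\<^sup>2 * D 0 - 2 * a + 1"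
      unfolding s1 x1 D1 using a by (simp add: power2_eq_square algebra_simps)
    finally show ?thesis .
  qed
  show False
  proof (cases "a > 3/2")
    case True
    have "a\<^sup>2 * D 0 \<ge> 0" using D0 by simp
    then have "2 * a - 1 \<le> \<bar>D 2\<bar>" unfolding D2 mult_minus_left by linarith
    then have "(2 * a - 1) * (a - 1) \<le> 1"
      using D_le[of 2] mult_right_mono[of "2*a-1" "\<bar>D 2\<bar>" "a - 1"] a by linarith
    \<comment> \<open>This is \<open>(2 * a - 1) * (a - 1) - 1\<close>, whose sign change at 3/2
      dictates the case split.\<close>
    moreover have "2 * (a - 3/2) * a > 0" using True by simp
    ultimately show False by (simp add: algebra_simps)
  next
    case False
    \<comment> \<open>For slopes up to 3/2 both \<open>x 2\<close> and \<open>x 3\<close> are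
      positive, so the signs are known for two more steps.\<close>
    have "x 2 = 1 - a * \<bar>x 1\<bar>" using x[of 1] by (simp add: numeral_2_eq_2)
    then have x2: "x 2 = 1 + a - a\<^sup>2"
      unfolding x1 using a by (simp add: power2_eq_square algebra_simps)
    have "a\<^sup>2 \<le> (3/2) * a"
      unfolding power2_eq_square using False a by (intro mult_right_mono) auto
    then have x2_pos: "x 2 > 0" unfolding x2 using a False by linarith
    have "D 3 = - a * D 2 - x 2"
      using D[of 2] s_pos[OF x2_pos] x2_pos by (simp add: eval_nat_numeral)
    then have D3: "D 3 = a^3 * D 0 + 3 * a\<^sup>2 - 2 * a - 1"
      unfolding D2 x2 by (simp add: eval_nat_numeral algebra_simps)
    have "x 3 = 1 - a * x 2" using x[of 2] x2_pos by (simp add: eval_nat_numeral)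
    then have x3: "x 3 = (a - 1)\<^sup>2 * (a + 1)"
      unfolding x2 by (simp add: eval_nat_numeral algebra_simps)
    then have x3_pos: "x 3 > 0" using a by simp
    have "D 4 = - a * D 3 - x 3"
      using D[of 3] s_pos[OF x3_pos] x3_pos by (simp add: eval_nat_numeral)
    then have D4: "D 4 = - (a^4 * D 0) - (4 * a^3 - 3 * a\<^sup>2 - 2 * a + 1)"
      unfolding D3 x3 by (simp add: eval_nat_numeral algebra_simps)
    \<comment> \<open>The right-hand side is 5.096 and 2 * a is at most 3, so the constant in
      \<open>D4\<close> is at least 3. Since a - 1 \<ge> 2/5, the product in \<open>D_le\<close> is
      then at least 6/5.\<close>
    have "a\<^sup>2 * (4 * a - 3) \<ge> (7/5)\<^sup>2 * (4 * (7/5) - 3)"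
      using a by (intro mult_mono power_mono) auto
    then have low: "4 * a^3 - 3 * a\<^sup>2 - 2 * a + 1 \<ge> 3"
      using False a by (simp add: eval_nat_numeral algebra_simps)
    have "a^4 * D 0 \<ge> 0" using D0 a by simp
    then have "\<bar>D 4\<bar> \<ge> 3" unfolding D4 using low by linarith
    then have "3 * (2/5) \<le> \<bar>D 4\<bar> * (a - 1)" using a by (intro mult_mono) auto
    with D_le[of 4] show False by simp
  qed
qed

text \<open>
  Small slopes are reduced to large ones by renormalisation: for \<open>a\<^sup>2 \<le> 2\<close> the odd-indexed
  points satisfy \<open>x (2 * j + 1) = (1 - a) * z j\<close> where \<open>z\<close> is an orbit of the tent map of slope
  \<open>a\<^sup>2\<close>. By the chain rule, \<open>D (2 * j + 1) = - z j + (1 - a) * (2 * a) * E j\<close> where \<open>E\<close> is the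
  derivative of \<open>z\<close> with respect to \<open>a\<^sup>2\<close>.
\<close>

lemma tent_transversality:
  fixes x s D :: "nat \<Rightarrow> real"
  assumes a: "1 < a" "a \<le> 2"
    and x0: "x 0 = 1" and x: "\<And>n. x (Suc n) = 1 - a * \<bar>x n\<bar>"
    and s: "\<And>n. s n = 1 \<or> s n = -1" and sx: "\<And>n. s n * x n = \<bar>x n\<bar>"
    and D: "\<And>n. D (Suc n) = - a * s n * D n - \<bar>x n\<bar>" and bounded: "\<And>n. \<bar>D n\<bar> \<le> K"
  shows "D 0 < 0"
proof -
  \<comment> \<open>Each renormalisation squares the slope, so m of them lift it to at least
    7/5.\<close>
  obtain m where "7/5 < a ^ m" using real_arch_pow[OF a(1)] by blast
  also have "a ^ m \<le> a ^ (2 ^ m)" using a by (intro power_increasing) auto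
  finally have "7/5 \<le> a ^ (2 ^ m)" by simp
  then show ?thesis using assms
  proof (induction m arbitrary: a x s D K)
    case 0
    then show ?case using tent_transversality_large_slope[of a x s D K] by simp
  next
    case (Suc m)
    note a = Suc.prems(2,3) and x0 = Suc.prems(4) and x = Suc.prems(5)
      and s = Suc.prems(6) and sx = Suc.prems(7) and D = Suc.prems(8) and bounded = Suc.prems(9)
    show ?case
    proof (cases "7/5 \<le> a")
      case True
      then show ?thesis using tent_transversality_large_slope[of a x s D K] Suc.prems by simp
    next
      case False
      have "a * a \<le> (7/5) * (7/5)" using False a by (intro mult_mono) auto
      then have a2: "1 < a\<^sup>2" "a\<^sup>2 \<le> 2" using a by (auto simp: power2_eq_square less_1_mult)
      \<comment> \<open>Odd-indexed points stay in [1 - a, a - 1], and there a * (a - 1) < 1. Hence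
        all even-indexed signs are +1 and two steps together fold only once.\<close>
      have even_pos: "x (2*j+2) > 0" if "\<bar>x (2*j+1)\<bar> \<le> a - 1" for j
      proof -
        have "a * \<bar>x (2*j+1)\<bar> \<le> a * (a - 1)" using that a by (intro mult_left_mono) auto
        also have "\<dots> < 1" using a2 a by (simp add: power2_eq_square algebra_simps)
        finally show ?thesis using x[of "2*j+1"] by simp
      qed
      have step: "x (2*j+3) = 1 - a + a\<^sup>2 * \<bar>x (2*j+1)\<bar>" if "\<bar>x (2*j+1)\<bar> \<le> a - 1" for j
      proof -
        have "x (2*j+3) = 1 - a * x (2*j+2)"
          using even_pos[OF that] x[of "2*j+2"] by (simp add: eval_nat_numeral)
        also have "x (2*j+2) = 1 - a * \<bar>x (2*j+1)\<bar>"
          using x[of "2*j+1"] by simp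
        finally show ?thesis by (simp add: power2_eq_square algebra_simps)
      qed
      have odd_le: "\<bar>x (2*j+1)\<bar> \<le> a - 1" for j
      proof (induction j)
        case 0
        then show ?case using x[of 0] x0 a by simp
      next
        case (Suc j)
        have "a\<^sup>2 * \<bar>x (2*j+1)\<bar> \<le> 2 * (a - 1)" using Suc a2 a by (intro mult_mono) auto
        moreover have "0 \<le> a\<^sup>2 * \<bar>x (2*j+1)\<bar>" by simp
        ultimately show ?case using step[OF Suc] by (simp add: eval_nat_numeral algebra_simps)
      qed
      define z where "z = (\<lambda>j. x (2*j+1) / (1 - a))"
      define \<sigma> where "\<sigma> = (\<lambda>j. - s (2*j+1))"
      define E where "E = (\<lambda>j. (D (2*j+1) + z j) / (2 * a * (1 - a)))"
      have xz: "x (2*j+1) = (1 - a) * z j" for j using a by (simp add: z_def)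
      have absz: "\<bar>x (2*j+1)\<bar> = (a - 1) * \<bar>z j\<bar>" for j unfolding xz using a by (simp add: abs_mult)
      have DE: "D (2*j+1) = - z j + 2 * a * (1 - a) * E j" for j using a by (simp add: E_def)
      have z_Suc: "z (Suc j) = 1 - a\<^sup>2 * \<bar>z j\<bar>" for j
      proof -
        have "(1 - a) * z (Suc j) = (1 - a) * (1 - a\<^sup>2 * \<bar>z j\<bar>)"
          using step[OF odd_le, of j] xz[of "Suc j"] unfolding absz
          by (simp add: eval_nat_numeral algebra_simps)
        then show ?thesis using a by simp
      qed
      have \<sigma>z: "\<sigma> j * z j = \<bar>z j\<bar>" for j
      proof -
        have "(a - 1) * (\<sigma> j * z j) = (a - 1) * \<bar>z j\<bar>"
          using sx[of "2*j+1"] unfolding absz unfolding xz by (simp add: \<sigma>_def algebra_simps)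
        then show ?thesis using a by simp
      qed
      have E_Suc: "E (Suc j) = - a\<^sup>2 * \<sigma> j * E j - \<bar>z j\<bar>" for j
      proof -
        have s_even: "s (2*j+2) = 1"
          using s[of "2*j+2"] sx[of "2*j+2"] even_pos[OF odd_le, of j] by auto
        have idx: "2 * Suc j + 1 = 2*j+3" by simp
        have "D (2*j+3) = - a * D (2*j+2) - x (2*j+2)"
          using D[of "2*j+2"] s_even even_pos[OF odd_le, of j] by (simp add: eval_nat_numeral)
        also have "D (2*j+2) = a * \<sigma> j * D (2*j+1) - \<bar>x (2*j+1)\<bar>"
          using D[of "2*j+1"] by (simp add: \<sigma>_def)
        also have "x (2*j+2) = 1 - a * \<bar>x (2*j+1)\<bar>"
          using x[of "2*j+1"] by simp
        also have "- a * (a * \<sigma> j * D (2*j+1) - \<bar>x (2*j+1)\<bar>) - (1 - a * \<bar>x (2*j+1)\<bar>)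
            = - a\<^sup>2 * \<sigma> j * D (2*j+1) + 2 * a * \<bar>x (2*j+1)\<bar> - 1"
          by (simp add: power2_eq_square algebra_simps)
        also have "\<dots> = a\<^sup>2 * (\<sigma> j * z j) - 1 + 2 * a * (1 - a) * (- a\<^sup>2 * \<sigma> j * E j - \<bar>z j\<bar>)"
          unfolding DE absz by (simp add: algebra_simps)
        also have "\<dots> = - z (Suc j) + 2 * a * (1 - a) * (- a\<^sup>2 * \<sigma> j * E j - \<bar>z j\<bar>)"
          unfolding \<sigma>z z_Suc by simp
        finally have "2 * a * (1 - a) * E (Suc j) = 2 * a * (1 - a) * (- a\<^sup>2 * \<sigma> j * E j - \<bar>z j\<bar>)"
          using DE[of "Suc j"] unfolding idx by linarith
        then show ?thesis using a by simp
      qed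
      have z_le: "\<bar>z j\<bar> \<le> 1" for j using odd_le[of j] a unfolding absz by simp
      have "E 0 < 0"
      proof (rule Suc.IH[where a = "a\<^sup>2" and x = z and s = \<sigma> and K = "(K + 1) / (2 * a * (a - 1))"])
        show "7/5 \<le> (a\<^sup>2) ^ (2 ^ m)" using Suc.prems(1) by (simp flip: power_mult)
        show "z 0 = 1" using x[of 0] x0 a by (simp add: z_def)
        show "\<sigma> n = 1 \<or> \<sigma> n = - 1" for n using s[of "2*n+1"] by (auto simp: \<sigma>_def)
        show "\<bar>E n\<bar> \<le> (K + 1) / (2 * a * (a - 1))" for n
        proof -
          have "\<bar>D (2*n+1) + z n\<bar> \<le> K + 1" using bounded[of "2*n+1"] z_le[of n] by linarith
          then show ?thesis unfolding E_def abs_divide using a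
            by (auto simp: abs_mult intro!: divide_right_mono)
        qed
      qed (fact a2 z_Suc \<sigma>z E_Suc)+
      \<comment> \<open>Comparing the two expressions for \<open>D 1\<close> and using
        \<open>z 0 = 1\<close> cancels the constant -1. As 1 - a < 0, it follows that
        \<open>D 0\<close> and \<open>E 0\<close> have the same sign.\<close>
      moreover have "s 0 = 1" using s[of 0] sx[of 0] x0 by auto
      then have "- (a * D 0) = 2 * a * (1 - a) * E 0"
        using D[of 0] DE[of 0] x[of 0] x0 xz[of 0] a by (simp add: z_def)
      moreover have "2 * a * (1 - a) * E 0 > 0" using \<open>E 0 < 0\<close> a
        by (simp add: mult_pos_neg mult_neg_neg)
      ultimately have "a * D 0 < 0" by linarith
      then show ?thesis using a by (simp add: mult_less_0_iff)
    qed
  qed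
qed

text \<open>Tychonoff's theorem gives compactness of the product, and countability of the index set
  makes it first countable, hence sequentially compact.\<close>

lemma pointwise_convergent_subsequence:
  fixes F :: "nat \<Rightarrow> 'i::countable \<Rightarrow> 'a::first_countable_topology"
  assumes C: "compact C" and F: "\<And>k i. F k i \<in> C"
  obtains r l where "strict_mono (r :: nat \<Rightarrow> nat)" "\<And>i. (\<lambda>k. F (r k) i) \<longlonglongrightarrow> l i"
proof -
  have "compactin (product_topology (\<lambda>_. euclidean) UNIV) (\<Pi>\<^sub>E i\<in>(UNIV::'i set). C)"
    using C by (simp add: compactin_PiE)
  then have "compact (\<Pi>\<^sub>E i\<in>(UNIV::'i set). C)"
    by (simp add: euclidean_product_topology)
  then have "seq_compact (\<Pi>\<^sub>E i\<in>(UNIV::'i set). C)"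
    by (rule compact_imp_seq_compact)
  then obtain l r where r: "strict_mono (r :: nat \<Rightarrow> nat)" and lim: "(F \<circ> r) \<longlonglongrightarrow> l"
    using F by (auto elim!: seq_compactE[where f = F] simp: PiE_iff)
  have "(\<lambda>k. F (r k) i) \<longlonglongrightarrow> l i" for i
    using continuous_on_tendsto_compose[OF continuous_on_product_coordinates lim, of i]
    by (simp add: o_def)
  with r show ?thesis by (rule that)
qed

text \<open>By compactness: counterexamples with errors 1 / (k + 1) would converge coordinatewise,
  along a subsequence, to an exact tent orbit with \<open>D 0 \<ge> 0\<close>, against
  \<open>tent_transversality\<close>. The \<epsilon> obtained depends on a and K alone, which leaves
  room for perturbing the slope and adding the b-term.\<close>

lemma tent_transversality_robust:
  fixes a K :: real
  assumes a: "1 < a" "a \<le> 2"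
  obtains \<epsilon> where "\<epsilon> > 0"
    "\<And>x s D :: nat \<Rightarrow> real. \<lbrakk>\<And>n. s n = 1 \<or> s n = -1; \<And>n. s n * x n = \<bar>x n\<bar>;
       \<And>n. \<bar>x n\<bar> \<le> K; \<And>n. \<bar>D n\<bar> \<le> K; \<bar>x 0 - 1\<bar> \<le> \<epsilon>;
       \<And>n. \<bar>x (Suc n) - (1 - a * \<bar>x n\<bar>)\<bar> \<le> \<epsilon>;
       \<And>n. \<bar>D (Suc n) - (- a * s n * D n - \<bar>x n\<bar>)\<bar> \<le> \<epsilon>\<rbrakk> \<Longrightarrow> D 0 \<le> - \<epsilon>"
proof -
  define P where "P = (\<lambda>\<epsilon> (x :: nat \<Rightarrow> real) s D. (\<forall>n. s n = 1 \<or> s n = -1) \<and>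
       (\<forall>n. s n * x n = \<bar>x n\<bar>) \<and> (\<forall>n. \<bar>x n\<bar> \<le> K) \<and> (\<forall>n. \<bar>D n\<bar> \<le> K) \<and> \<bar>x 0 - 1\<bar> \<le> \<epsilon> \<and>
       (\<forall>n. \<bar>x (Suc n) - (1 - a * \<bar>x n\<bar>)\<bar> \<le> \<epsilon>) \<and>
       (\<forall>n. \<bar>D (Suc n) - (- a * s n * D n - \<bar>x n\<bar>)\<bar> \<le> \<epsilon>))"
  have "\<exists>\<epsilon>>0. \<forall>x s D. P \<epsilon> x s D \<longrightarrow> D 0 \<le> - \<epsilon>"
  proof (rule ccontr)
    assume neg: "\<not> ?thesis"
    have "\<exists>x s D. P (1 / real (Suc k)) x s D \<and> D 0 > - (1 / real (Suc k))" for k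
      using neg by (force simp: not_le)
    then obtain X S E where XSE: "\<And>k. P (1 / real (Suc k)) (X k) (S k) (E k)"
      and E0: "\<And>k. E k 0 > - (1 / real (Suc k))" by metis
    have C: "compact ({-K..K} \<times> {-1..1::real} \<times> {-K..K})"
      by (intro compact_Times compact_Icc)
    have XSE_mem: "(X k i, S k i, E k i) \<in> {-K..K} \<times> {-1..1} \<times> {-K..K}" for k i
    proof -
      have "\<bar>X k i\<bar> \<le> K" "\<bar>E k i\<bar> \<le> K" "S k i = 1 \<or> S k i = -1"
        using XSE[of k] unfolding P_def by blast+
      then show ?thesis by auto
    qed
    obtain r l where r: "strict_mono r"
      and lim: "\<And>i. (\<lambda>k. (X (r k) i, S (r k) i, E (r k) i)) \<longlonglongrightarrow> l i"
      by (rule pointwise_convergent_subsequence[where F = "\<lambda>k i. (X k i, S k i, E k i)", OF C XSE_mem])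
        (rule that)
    define x where "x = (\<lambda>i. fst (l i))"
    define s where "s = (\<lambda>i. fst (snd (l i)))"
    define D where "D = (\<lambda>i. snd (snd (l i)))"
    have x: "(\<lambda>k. X (r k) i) \<longlonglongrightarrow> x i" for i
      using tendsto_fst[OF lim[of i]] by (simp add: x_def)
    have s: "(\<lambda>k. S (r k) i) \<longlonglongrightarrow> s i" for i
      using tendsto_fst[OF tendsto_snd[OF lim[of i]]] by (simp add: s_def)
    have D: "(\<lambda>k. E (r k) i) \<longlonglongrightarrow> D i" for i
      using tendsto_snd[OF tendsto_snd[OF lim[of i]]] by (simp add: D_def)
    have e: "(\<lambda>k. 1 / real (Suc (r k))) \<longlonglongrightarrow> 0"
      using LIMSEQ_subseq_LIMSEQ[OF LIMSEQ_Suc[OF lim_const_over_n[of 1]] r]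
      by (simp add: o_def)
    \<comment> \<open>Turns a defect that is at most 1 / (k + 1) into an exact equation for the
      limit.\<close>
    have zero: "u = 0" if "(\<lambda>k. U (r k)) \<longlonglongrightarrow> u" "\<And>k. \<bar>U k\<bar> \<le> 1 / real (Suc k)" for U :: "nat \<Rightarrow> real" and u
    proof -
      have "(\<lambda>k. U (r k)) \<longlonglongrightarrow> 0"
        by (rule Lim_null_comparison[OF _ e]) (use that(2) in auto)
      with that(1) show ?thesis using LIMSEQ_unique by blast
    qed
    have "D 0 < 0"
    proof (rule tent_transversality[OF a])
      have "x 0 - 1 = 0"
        by (rule zero[where U = "\<lambda>k. X k 0 - 1"])
          (use XSE in \<open>auto intro!: tendsto_intros x simp: P_def\<close>)
      then show "x 0 = 1" by simp
      fix n
      have "x (Suc n) - (1 - a * \<bar>x n\<bar>) = 0"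
        by (rule zero[where U = "\<lambda>k. X k (Suc n) - (1 - a * \<bar>X k n\<bar>)"])
          (use XSE in \<open>auto intro!: tendsto_intros x simp: P_def\<close>)
      then show "x (Suc n) = 1 - a * \<bar>x n\<bar>" by simp
      have "D (Suc n) - (- a * s n * D n - \<bar>x n\<bar>) = 0"
        by (rule zero[where U = "\<lambda>k. E k (Suc n) - (- a * S k n * E k n - \<bar>X k n\<bar>)"])
          (use XSE in \<open>auto intro!: tendsto_intros x s D simp: P_def\<close>)
      then show "D (Suc n) = - a * s n * D n - \<bar>x n\<bar>" by simp
      have "S k n * X k n = \<bar>X k n\<bar>" for k using XSE[of k] by (simp add: P_def)
      then have "s n * x n - \<bar>x n\<bar> = 0"
        by (intro zero[where U = "\<lambda>k. S k n * X k n - \<bar>X k n\<bar>"] tendsto_intros s x) simp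
      then show "s n * x n = \<bar>x n\<bar>" by simp
      have "\<bar>S k n\<bar> = 1" for k
      proof -
        have "S k n = 1 \<or> S k n = -1" using XSE[of k] by (simp add: P_def)
        then show ?thesis by auto
      qed
      then have "\<bar>s n\<bar> - 1 = 0"
        by (intro zero[where U = "\<lambda>k. \<bar>S k n\<bar> - 1"] tendsto_intros s) simp
      then show "s n = 1 \<or> s n = - 1" by linarith
      show "\<bar>D n\<bar> \<le> K"
        by (rule Lim_bounded[OF tendsto_rabs[OF D]]) (use XSE in \<open>auto simp: P_def\<close>)
    qed
    moreover have "D 0 \<ge> - 0"
      by (rule LIMSEQ_le[OF tendsto_minus[OF e] D]) (use E0 in \<open>auto intro: less_imp_le\<close>)
    ultimately show False by simp
  qed
  then show ?thesis using that unfolding P_def by blast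
qed

section \<open>Bounded orbits with prescribed signs\<close>

text \<open>
  A bounded orbit whose signs are prescribed to be \<open>s\<close>: it is an actual orbit of the Lozi map
  precisely when \<open>s n * x n \<ge> 0\<close> for all \<open>n\<close>.
\<close>

definition signed_solution :: "real \<Rightarrow> real \<Rightarrow> (int \<Rightarrow> real) \<Rightarrow> (int \<Rightarrow> real) \<Rightarrow> bool" where
  "signed_solution a b s x \<longleftrightarrow> bounded (range x) \<and>
     (\<forall>n. s n = 1 \<or> s n = -1) \<and> (\<forall>n. x (n + 1) = 1 - a * (s n * x n) + b * x (n - 1))"

definition bounded_lozi_orbit :: "real \<times> real \<Rightarrow> (int \<Rightarrow> real) \<Rightarrow> bool" where
  "bounded_lozi_orbit p x \<longleftrightarrow> bounded (range x) \<and>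
     (\<forall>n. (x (n + 1), x n) = lozi p (x n, x (n - 1)))"

lemma lozi_orbit_signed_solution:
  assumes "bounded_lozi_orbit (a, b) x"
  shows "signed_solution a b (\<lambda>n. if x n \<ge> 0 then 1 else - 1) x"
proof -
  have abs: "(if x n \<ge> 0 then 1 else - 1) * x n = \<bar>x n\<bar>" for n by simp
  show ?thesis using assms unfolding signed_solution_def bounded_lozi_orbit_def abs by simp
qed

lemma signed_solution_lozi_orbit:
  assumes "signed_solution a b s x" and "\<And>n. s n * x n \<ge> 0"
  shows "bounded_lozi_orbit (a, b) x"
proof -
  have "s n * x n = \<bar>x n\<bar>" for n
  proof -
    have "s n = 1 \<or> s n = -1" using assms(1) by (simp add: signed_solution_def)
    then show ?thesis using assms(2)[of n] by auto
  qed
  then show ?thesis using assms(1) by (simp add: signed_solution_def bounded_lozi_orbit_def)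
qed

text \<open>As \<open>s n\<close> is its own inverse, the middle term can be expressed by its two
  neighbours. For a > 1 + \<bar>b\<bar> this form contracts in the supremum norm by (1 +
  \<bar>b\<bar>) / a, also at b = 0 where the Lozi map is not invertible.\<close>

lemma signed_solution_isolate:
  assumes "signed_solution a b s x"
  shows "a * x n = s n * (1 - x (n + 1) + b * x (n - 1))"
proof -
  have "s n = 1 \<or> s n = -1" using assms by (simp add: signed_solution_def)
  then have "s n * s n = 1" by auto
  then have "a * x n = s n * (a * (s n * x n))" by (simp add: mult.left_commute)
  also have "a * (s n * x n) = 1 - x (n + 1) + b * x (n - 1)"
    using assms by (simp add: signed_solution_def)
  finally show ?thesis .
qed

text \<open>The contraction bound with factor (1 + \<bar>b\<bar>) / a. It serves orbits (c = 1) as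
  well as difference quotients of orbits (c = 2 * M).\<close>

lemma coupled_recurrence_bound:
  fixes u :: "int \<Rightarrow> real"
  assumes ab: "a > 1 + \<bar>b\<bar>" and bounded: "bounded (range u)"
    and le: "\<And>n. a * \<bar>u n\<bar> \<le> c + \<bar>u (n + 1)\<bar> + \<bar>b\<bar> * \<bar>u (n - 1)\<bar>"
  shows "\<bar>u n\<bar> \<le> c / (a - 1 - \<bar>b\<bar>)"
proof -
  obtain B where B: "\<And>n. \<bar>u n\<bar> \<le> B" using bounded by (auto simp: bounded_iff)
  have "\<bar>u n\<bar> \<le> (c / a) / (1 - (1 + \<bar>b\<bar>) / a)"
  proof (rule sup_contraction_bound[OF B])
    fix B n assume B: "\<And>j. \<bar>u j\<bar> \<le> B"
    have "a * \<bar>u n\<bar> \<le> c + B + \<bar>b\<bar> * B"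
      using le[of n] B[of "n + 1"] mult_left_mono[OF B[of "n - 1"], of "\<bar>b\<bar>"] by linarith
    then show "\<bar>u n\<bar> \<le> c / a + (1 + \<bar>b\<bar>) / a * B" using ab by (simp add: field_simps)
  qed (use ab in auto)
  also have "(c / a) / (1 - (1 + \<bar>b\<bar>) / a) = c / (a - 1 - \<bar>b\<bar>)"
    using ab by (simp add: field_simps)
  finally show ?thesis .
qed

lemma signed_solution_bound:
  assumes ab: "a > 1 + \<bar>b\<bar>" and x: "signed_solution a b s x"
  shows "\<bar>x n\<bar> \<le> 1 / (a - 1 - \<bar>b\<bar>)"
proof (rule coupled_recurrence_bound[OF ab])
  fix n
  have "s n = 1 \<or> s n = -1" using x by (simp add: signed_solution_def)
  then have "\<bar>s n\<bar> = 1" by auto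
  moreover have "a > 0" using ab by linarith
  ultimately have "a * \<bar>x n\<bar> = \<bar>1 - x (n + 1) + b * x (n - 1)\<bar>"
    using arg_cong[OF signed_solution_isolate[OF x, of n], of abs] by (simp add: abs_mult)
  also have "\<dots> \<le> 1 + \<bar>x (n + 1)\<bar> + \<bar>b\<bar> * \<bar>x (n - 1)\<bar>"
    using abs_mult[of b "x (n - 1)"] by linarith
  finally show "a * \<bar>x n\<bar> \<le> 1 + \<bar>x (n + 1)\<bar> + \<bar>b\<bar> * \<bar>x (n - 1)\<bar>" .
qed (use x in \<open>simp add: signed_solution_def\<close>)

text \<open>Picard iteration from 0. The radius M solves 1 + (1 + \<bar>b\<bar>) * M = a * M, so T
  preserves the ball of radius M. A pointwise limit along a subsequence is a fixed point because
  consecutive iterates approach each other geometrically.\<close>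

lemma signed_solution_exists:
  assumes ab: "a > 1 + \<bar>b\<bar>" and s: "\<And>n. s n = 1 \<or> s n = -1"
  obtains x where "signed_solution a b s x"
proof -
  define T where "T = (\<lambda>g :: int \<Rightarrow> real. \<lambda>n. s n * (1 - g (n + 1) + b * g (n - 1)) / a)"
  define \<theta> where "\<theta> = (1 + \<bar>b\<bar>) / a"
  define M where "M = 1 / (a - 1 - \<bar>b\<bar>)"
  define X where "X = (\<lambda>k. (T ^^ k) (\<lambda>_. 0))"
  have a: "a > 0" using ab by linarith
  have \<theta>: "0 \<le> \<theta>" "\<theta> < 1" using ab by (auto simp: \<theta>_def)
  have abs_s: "\<bar>s n\<bar> = 1" for n using s[of n] by auto
  have lin: "\<bar>u + b * v\<bar> \<le> C + \<bar>b\<bar> * B" if "\<bar>u\<bar> \<le> C" "\<bar>v\<bar> \<le> B" for u v B C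
    using that(1) mult_left_mono[OF that(2), of "\<bar>b\<bar>"] abs_mult[of b v] by linarith
  have T_bound: "\<bar>T g n\<bar> \<le> M" if "\<And>m. \<bar>g m\<bar> \<le> M" for g n
  proof -
    have "\<bar>1 - g (n + 1) + b * g (n - 1)\<bar> \<le> (1 + M) + \<bar>b\<bar> * M"
      by (rule lin) (use that[of "n + 1"] that[of "n - 1"] in linarith)+
    also have "\<dots> = a * M"
    proof -
      have "(a - 1 - \<bar>b\<bar>) * M = 1" using ab by (simp add: M_def)
      then show ?thesis by (simp add: algebra_simps)
    qed
    finally show ?thesis using a by (simp add: T_def abs_mult abs_s divide_le_eq mult.commute)
  qed
  have T_contract: "\<bar>T g n - T h n\<bar> \<le> \<theta> * B" if "\<And>m. \<bar>g m - h m\<bar> \<le> B" for g h n B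
  proof -
    have "T g n - T h n = s n * (- (g (n + 1) - h (n + 1)) + b * (g (n - 1) - h (n - 1))) / a"
      by (simp add: T_def algebra_simps diff_divide_distrib add_divide_distrib)
    then have "a * \<bar>T g n - T h n\<bar> = \<bar>- (g (n + 1) - h (n + 1)) + b * (g (n - 1) - h (n - 1))\<bar>"
      using a by (simp add: abs_mult abs_s)
    also have "\<dots> \<le> B + \<bar>b\<bar> * B"
      by (rule lin) (use that[of "n + 1"] that[of "n - 1"] in linarith)+
    finally show ?thesis using a by (simp add: \<theta>_def field_simps)
  qed
  have X_Suc: "X (Suc k) = T (X k)" for k by (simp add: X_def)
  have X_bound: "\<bar>X k n\<bar> \<le> M" for k n
  proof (induction k arbitrary: n)
    case 0
    then show ?case using ab by (simp add: X_def M_def)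
  qed (simp add: X_Suc T_bound)
  have X_diff: "\<bar>X (Suc k) n - X k n\<bar> \<le> \<theta> ^ k * M" for k n
  proof (induction k arbitrary: n)
    case 0
    then show ?case using X_bound[of 1 n] by (simp add: X_def)
  next
    case (Suc k)
    have "\<bar>T (X (Suc k)) n - T (X k) n\<bar> \<le> \<theta> * (\<theta> ^ k * M)"
      by (rule T_contract) (rule Suc)
    then show ?case by (simp add: X_Suc mult.assoc)
  qed
  obtain r g where r: "strict_mono (r :: nat \<Rightarrow> nat)" and lim: "\<And>n. (\<lambda>k. X (r k) n) \<longlonglongrightarrow> g n"
    by (rule pointwise_convergent_subsequence[where F = X and C = "{-M..M}"])
      (use X_bound in \<open>auto simp: abs_le_iff minus_le_iff\<close>)
  have g_bound: "\<bar>g n\<bar> \<le> M" for n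
    by (rule Lim_bounded[OF tendsto_rabs[OF lim]]) (use X_bound in auto)
  have "T g n - g n = 0" for n
  proof -
    have "(\<lambda>k. T (X (r k)) n - X (r k) n) \<longlonglongrightarrow> T g n - g n"
      unfolding T_def using a by (intro tendsto_intros lim) auto
    moreover have "(\<lambda>k. T (X (r k)) n - X (r k) n) \<longlonglongrightarrow> 0"
    proof (rule Lim_null_comparison)
      show "\<forall>\<^sub>F k in sequentially. norm (T (X (r k)) n - X (r k) n) \<le> \<theta> ^ r k * M"
        using X_diff by (simp add: X_Suc)
      show "(\<lambda>k. \<theta> ^ r k * M) \<longlonglongrightarrow> 0"
        using tendsto_mult_left_zero[OF LIMSEQ_subseq_LIMSEQ[OF LIMSEQ_power_zero[of \<theta>] r]] \<theta>
        by (simp add: o_def)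
    qed
    ultimately show ?thesis by (rule LIMSEQ_unique)
  qed
  then have "a * g n = s n * (1 - g (n + 1) + b * g (n - 1))" for n
    using a by (simp add: T_def field_simps)
  then have "a * (s n * g n) = (s n * s n) * (1 - g (n + 1) + b * g (n - 1))" for n
    by (simp add: mult.assoc mult.left_commute)
  moreover have "s n * s n = 1" for n using s[of n] by auto
  ultimately have "g (n + 1) = 1 - a * (s n * g n) + b * g (n - 1)" for n by simp
  moreover have "bounded (range g)" using g_bound by (auto simp: bounded_iff)
  ultimately have "signed_solution a b s g" using s by (simp add: signed_solution_def)
  then show ?thesis by (rule that)
qed

text \<open>Each use of the isolated recurrence widens the window by one index on both sides and
  gains a factor (1 + \<bar>b\<bar>) / a; after k uses the a priori bounds of both solutions finish
  the estimate.\<close>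

lemma signed_solutions_close:
  assumes ab: "a > 1 + \<bar>b\<bar>" and x: "signed_solution a b s x" and x': "signed_solution a b s' x'"
    and eq: "\<And>j. \<bar>j - n\<bar> \<le> int k \<Longrightarrow> s j = s' j"
  shows "\<bar>x n - x' n\<bar> \<le> 2 / (a - 1 - \<bar>b\<bar>) * ((1 + \<bar>b\<bar>) / a) ^ k"
  using eq
proof (induction k arbitrary: n)
  case 0
  show ?case using signed_solution_bound[OF ab x, of n] signed_solution_bound[OF ab x', of n] by simp
next
  case (Suc k)
  define B where "B = 2 / (a - 1 - \<bar>b\<bar>) * ((1 + \<bar>b\<bar>) / a) ^ k"
  have B: "\<bar>x (n + 1) - x' (n + 1)\<bar> \<le> B" "\<bar>x (n - 1) - x' (n - 1)\<bar> \<le> B"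
    unfolding B_def by (rule Suc.IH; use Suc.prems in force)+
  have "s n = 1 \<or> s n = -1" using x by (simp add: signed_solution_def)
  then have sn: "s' n = s n" "\<bar>s n\<bar> = 1" using Suc.prems[of n] by auto
  have a: "a > 0" using ab by linarith
  have "a * (x n - x' n) = s n * (- (x (n + 1) - x' (n + 1)) + b * (x (n - 1) - x' (n - 1)))"
    using signed_solution_isolate[OF x, of n] signed_solution_isolate[OF x', of n] sn
    by (simp add: algebra_simps)
  then have "a * \<bar>x n - x' n\<bar> = \<bar>- (x (n + 1) - x' (n + 1)) + b * (x (n - 1) - x' (n - 1))\<bar>"
    using a sn by (metis abs_mult abs_of_pos mult_1)
  also have "\<dots> \<le> B + \<bar>b\<bar> * B"
    using B(1) mult_left_mono[OF B(2), of "\<bar>b\<bar>"] abs_mult[of b "x (n - 1) - x' (n - 1)"] by linarith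
  finally have "\<bar>x n - x' n\<bar> \<le> B * ((1 + \<bar>b\<bar>) / a)" using a by (simp add: field_simps)
  then show ?case by (simp add: B_def mult_ac)
qed

section \<open>Continuation along a line\<close>

text \<open>For large N the direction (N, \<sigma>) is nearly that of increasing slope, whichever
  sign \<sigma> has. The order of quantifiers matters: \<kappa> depends on t and t' but not on the
  orbit, so it can serve as a scale of separation.\<close>

lemma lozi_line_continuation:
  fixes a \<sigma> :: real
  assumes a: "1 < a" "a \<le> 2" and \<sigma>: "\<bar>\<sigma>\<bar> = 1"
  obtains N \<delta> where "N > 0" "\<delta> > 0"
    "\<And>t. \<bar>t\<bar> < \<delta> \<Longrightarrow> a + N * t > 1 + \<bar>\<sigma> * t\<bar>"
    "\<And>t t'. \<lbrakk>\<bar>t\<bar> < \<delta>; \<bar>t'\<bar> < \<delta>; t < t'\<rbrakk> \<Longrightarrow>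
       \<exists>\<kappa>>0. \<forall>x. bounded_lozi_orbit (a + N * t, \<sigma> * t) x \<longrightarrow>
         (\<exists>y. bounded_lozi_orbit (a + N * t', \<sigma> * t') y \<and>
              (\<forall>n. (if x n \<ge> 0 then 1 else - 1) * y n \<ge> \<kappa>))"
proof -
  \<comment> \<open>Half of the gap a - 1 survives for small t, so M = 1 / g bounds all orbits, and
    K bounds orbits and difference quotients. These constants depend on a alone, hence so does
    \<epsilon>, and N and \<delta> can be chosen after it.\<close>
  define g where "g = (a - 1) / 2"
  define M where "M = 1 / g"
  define K where "K = M + 2 * M\<^sup>2"
  have g: "0 < g" "g \<le> 1/2" using a by (auto simp: g_def)
  have M: "M > 0" "M * g = 1" using g by (auto simp: M_def)
  have K: "K > 0" "M \<le> K" "2 * M\<^sup>2 \<le> K" using M by (auto simp: K_def add_pos_nonneg)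
  obtain \<epsilon> where \<epsilon>: "\<epsilon> > 0"
    "\<And>x s D :: nat \<Rightarrow> real. \<lbrakk>\<And>n. s n = 1 \<or> s n = -1; \<And>n. s n * x n = \<bar>x n\<bar>;
       \<And>n. \<bar>x n\<bar> \<le> K; \<And>n. \<bar>D n\<bar> \<le> K; \<bar>x 0 - 1\<bar> \<le> \<epsilon>;
       \<And>n. \<bar>x (Suc n) - (1 - a * \<bar>x n\<bar>)\<bar> \<le> \<epsilon>;
       \<And>n. \<bar>D (Suc n) - (- a * s n * D n - \<bar>x n\<bar>)\<bar> \<le> \<epsilon>\<rbrakk> \<Longrightarrow> D 0 \<le> - \<epsilon>"
    using tent_transversality_robust[OF a, of K] by metis
  \<comment> \<open>N makes the term \<open>\<sigma> * x (n - 1) / N\<close> at most \<epsilon> / 4;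
    \<delta> keeps the gap above g and the terms carrying t or t' below \<epsilon> / 32.\<close>
  define N where "N = max 1 (4 * K / \<epsilon>)"
  define \<delta> where "\<delta> = min g (\<epsilon> / (32 * K)) / (N + 1)"
  have N: "N \<ge> 1" "4 * K / \<epsilon> \<le> N" by (auto simp: N_def)
  have KN: "4 * K \<le> \<epsilon> * N" using N(2) \<epsilon>(1) by (simp add: field_simps)
  have \<delta>: "\<delta> > 0" using g K \<epsilon> N by (auto simp: \<delta>_def)
  have "(N + 1) * \<delta> = min g (\<epsilon> / (32 * K))" using N by (simp add: \<delta>_def)
  then have \<delta>_le: "(N + 1) * \<delta> \<le> g" "(N + 1) * \<delta> \<le> \<epsilon> / (32 * K)" by simp_all
  have \<delta>K: "(N + 1) * \<delta> * K \<le> \<epsilon> / 32"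
    using mult_right_mono[OF \<delta>_le(2), of K] K by simp
  have size: "\<bar>N * t\<bar> + \<bar>\<sigma> * t\<bar> \<le> (N + 1) * \<delta>" if "\<bar>t\<bar> < \<delta>" for t
  proof -
    have "\<bar>N * t\<bar> + \<bar>\<sigma> * t\<bar> = (N + 1) * \<bar>t\<bar>" using N \<sigma> by (simp add: abs_mult algebra_simps)
    also have "\<dots> \<le> (N + 1) * \<delta>" using that N by (intro mult_left_mono) auto
    finally show ?thesis .
  qed
  have gap: "a + N * t - 1 - \<bar>\<sigma> * t\<bar> \<ge> g" if "\<bar>t\<bar> < \<delta>" for t
  proof -
    have "a - 1 = 2 * g" by (simp add: g_def)
    then show ?thesis using size[OF that] \<delta>_le(1) by linarith
  qed
  have params: "a + N * t > 1 + \<bar>\<sigma> * t\<bar>" if "\<bar>t\<bar> < \<delta>" for t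
    using gap[OF that] g by linarith
  have inv_gap: "c / (a + N * t - 1 - \<bar>\<sigma> * t\<bar>) \<le> c * M" if "\<bar>t\<bar> < \<delta>" "c \<ge> 0" for t c
  proof -
    have "c / (a + N * t - 1 - \<bar>\<sigma> * t\<bar>) \<le> c / g"
      using gap[OF that(1)] g that(2) by (intro divide_left_mono) auto
    then show ?thesis by (simp add: M_def)
  qed
  have perturb: "\<bar>N * t * u\<bar> + \<bar>\<sigma> * t * v\<bar> \<le> \<epsilon> / 32"
    if "\<bar>t\<bar> < \<delta>" "\<bar>u\<bar> \<le> K" "\<bar>v\<bar> \<le> K" for t u v
  proof -
    have "\<bar>N * t * u\<bar> + \<bar>\<sigma> * t * v\<bar> \<le> \<bar>N * t\<bar> * K + \<bar>\<sigma> * t\<bar> * K"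
      using that by (simp add: abs_mult add_mono mult_left_mono)
    also have "\<dots> \<le> (N + 1) * \<delta> * K"
      using mult_right_mono[OF size[OF that(1)], of K] K by (simp add: distrib_right)
    finally show ?thesis using \<delta>K by linarith
  qed
  have continuation: "\<exists>y. bounded_lozi_orbit (a + N * t', \<sigma> * t') y \<and>
      (\<forall>n. (if x n \<ge> 0 then 1 else - 1) * y n \<ge> min (\<epsilon> / 16) (N * (t' - t) * (\<epsilon> / 8)))"
    if t: "\<bar>t\<bar> < \<delta>" "\<bar>t'\<bar> < \<delta>" "t < t'" and orbit: "bounded_lozi_orbit (a + N * t, \<sigma> * t) x" for t t' x
  proof -
    define s :: "int \<Rightarrow> real" where "s = (\<lambda>n. if x n \<ge> 0 then 1 else - 1)"
    have s: "s n = 1 \<or> s n = - 1" for n by (simp add: s_def)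
    have sx: "s n * x n = \<bar>x n\<bar>" for n by (simp add: s_def)
    have s_abs: "\<bar>s n\<bar> = 1" "s n * s n = 1" for n by (auto simp: s_def)
    define a1 b1 a2 b2 where ab: "a1 = a + N * t" "b1 = \<sigma> * t" "a2 = a + N * t'" "b2 = \<sigma> * t'"
    have x: "signed_solution a1 b1 s x"
      using lozi_orbit_signed_solution orbit unfolding s_def ab by blast
    have p2: "a2 > 1 + \<bar>b2\<bar>" using params[OF t(2)] by (simp add: ab)
    obtain y where y: "signed_solution a2 b2 s y"
      by (rule signed_solution_exists[OF p2 s]) (rule that)
    have xM: "\<bar>x n\<bar> \<le> M" for n
      using signed_solution_bound[OF params[OF t(1)] x[unfolded ab], of n] inv_gap[OF t(1), of 1] by simp
    have yM: "\<bar>y n\<bar> \<le> M" for n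
      using signed_solution_bound[OF params[OF t(2)] y[unfolded ab], of n] inv_gap[OF t(2), of 1] by simp
    have xK: "\<bar>x n\<bar> \<le> K" for n using xM[of n] K by linarith
    define \<tau> where "\<tau> = N * (t' - t)"
    have \<tau>: "\<tau> > 0" using t N by (simp add: \<tau>_def)
    \<comment> \<open>An exact difference quotient: it satisfies the recursion of the tent map derivative up to
      errors controlled by \<open>N\<close> and \<open>\<delta>\<close>, so no differentiability in \<open>t\<close> is needed.\<close>
    define D where "D = (\<lambda>n. (y n - x n) / \<tau>)"
    have y_eq: "y n = x n + \<tau> * D n" for n using \<tau> by (simp add: D_def)
    have a2_eq: "a2 = a1 + \<tau>" by (simp add: ab \<tau>_def algebra_simps)
    \<comment> \<open>When a grows by \<tau>, b moves only by \<sigma> * \<tau> / N: a large N makes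
      the variation of b negligible.\<close>
    have "\<sigma> * \<tau> / N = \<sigma> * (t' - t)" using N by (simp add: \<tau>_def)
    then have b2_eq: "b2 = b1 + \<sigma> * \<tau> / N" by (simp add: ab algebra_simps)
    have x_rec: "x (n + 1) = 1 - a1 * \<bar>x n\<bar> + b1 * x (n - 1)" for n
      using x sx unfolding signed_solution_def by simp
    have D_rec: "D (n + 1) = - a2 * s n * D n - \<bar>x n\<bar> + b2 * D (n - 1) + \<sigma> * x (n - 1) / N" for n
    proof -
      have "y (n + 1) = 1 - a2 * (s n * y n) + b2 * y (n - 1)"
        using y by (simp add: signed_solution_def)
      then have "x (n + 1) + \<tau> * D (n + 1) = 1 - a2 * \<bar>x n\<bar> - \<tau> * (a2 * s n * D n)
          + b2 * x (n - 1) + \<tau> * (b2 * D (n - 1))"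
        unfolding y_eq sx[of n, symmetric] by (simp add: algebra_simps)
      then have "\<tau> * D (n + 1) = \<tau> * (- a2 * s n * D n - \<bar>x n\<bar> + b2 * D (n - 1) + \<sigma> * x (n - 1) / N)"
        unfolding x_rec a2_eq b2_eq by (simp add: algebra_simps)
      then show ?thesis using \<tau> by simp
    qed
    have xN: "\<bar>\<sigma> * x n / N\<bar> \<le> \<epsilon> / 4" for n
    proof -
      have "\<bar>\<sigma> * x n / N\<bar> = \<bar>x n\<bar> / N" using \<sigma> N by (simp add: abs_mult)
      also have "\<dots> \<le> K / N" using xK[of n] N by (intro divide_right_mono) auto
      also have "\<dots> \<le> \<epsilon> / 4" using KN N by (simp add: field_simps)
      finally show ?thesis .
    qed
    have a2_pos: "a2 > 0" using p2 by linarith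
    have DK: "\<bar>D n\<bar> \<le> K" for n
    proof -
      have "\<bar>D n\<bar> \<le> 2 * M / (a2 - 1 - \<bar>b2\<bar>)"
      proof (rule coupled_recurrence_bound)
        show "a2 > 1 + \<bar>b2\<bar>" using p2 .
        have "\<bar>D n\<bar> \<le> 2 * M / \<tau>" for n
          using xM[of n] yM[of n] \<tau> by (simp add: D_def divide_right_mono)
        then show "bounded (range D)" by (auto simp: bounded_iff)
        fix n
        have "\<bar>\<sigma> * x (n - 1) / N\<bar> \<le> M / 1"
          unfolding abs_divide using xM[of "n - 1"] \<sigma> N M by (intro frac_le) (auto simp: abs_mult)
        moreover have "a2 * \<bar>D n\<bar> = \<bar>- a2 * s n * D n\<bar>" using a2_pos s_abs by (simp add: abs_mult)
        ultimately show "a2 * \<bar>D n\<bar> \<le> 2 * M + \<bar>D (n + 1)\<bar> + \<bar>b2\<bar> * \<bar>D (n - 1)\<bar>"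
          using D_rec[of n] xM[of n] abs_mult[of b2 "D (n - 1)"] by linarith
      qed
      also have "\<dots> \<le> 2 * M * M" using inv_gap[OF t(2), of "2 * M"] M unfolding ab by simp
      also have "\<dots> \<le> K" using K by (simp add: power2_eq_square)
      finally show ?thesis .
    qed
    have x_err: "\<bar>x (n + 1) - (1 - a * \<bar>x n\<bar>)\<bar> \<le> \<epsilon> / 32" for n
    proof -
      have "x (n + 1) - (1 - a * \<bar>x n\<bar>) = - (N * t * \<bar>x n\<bar>) + \<sigma> * t * x (n - 1)"
        unfolding x_rec ab by (simp add: algebra_simps)
      moreover have "\<bar>N * t * \<bar>x n\<bar>\<bar> + \<bar>\<sigma> * t * x (n - 1)\<bar> \<le> \<epsilon> / 32"
        by (rule perturb[OF t(1)]) (use xK in auto)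
      ultimately show ?thesis by linarith
    qed
    have D_err: "\<bar>D (n + 1) - (- a * s n * D n - \<bar>x n\<bar>)\<bar> \<le> \<epsilon> / 32 + \<epsilon> / 4" for n
    proof -
      have "D (n + 1) - (- a * s n * D n - \<bar>x n\<bar>)
          = - (N * t' * (s n * D n)) + \<sigma> * t' * D (n - 1) + \<sigma> * x (n - 1) / N"
        unfolding D_rec ab by (simp add: algebra_simps)
      moreover have "\<bar>N * t' * (s n * D n)\<bar> + \<bar>\<sigma> * t' * D (n - 1)\<bar> \<le> \<epsilon> / 32"
        by (rule perturb[OF t(2)]) (use DK s_abs in \<open>auto simp: abs_mult\<close>)
      ultimately show ?thesis using xN[of "n - 1"] by linarith
    qed
    \<comment> \<open>If \<open>\<bar>x n\<bar> \<le> \<epsilon> / 8\<close>, the next point is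
      within \<epsilon> of the critical value 1, so \<open>D (n + 1) \<le> - \<epsilon>\<close>, and
      one step back gives \<open>a * (s n * D n) \<ge> \<epsilon> / 2\<close>. Otherwise the
      displacement, at most \<tau> * K \<le> \<epsilon> / 16, is too small to reach 0.\<close>
    have lower: "s n * y n \<ge> min (\<epsilon> / 16) (\<tau> * (\<epsilon> / 8))" for n
    proof (cases "\<bar>x n\<bar> \<le> \<epsilon> / 8")
      case True
      have "a * \<bar>x n\<bar> \<le> 2 * (\<epsilon> / 8)" using True a by (intro mult_mono) auto
      moreover have "0 \<le> a * \<bar>x n\<bar>" using a by simp
      ultimately have near: "\<bar>x (n + 1) - 1\<bar> \<le> \<epsilon>" using x_err[of n] \<epsilon>(1) by linarith
      \<comment> \<open>The sequences fed to transversality are the forward halves starting at n +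
        1; \<open>int 0\<close> is kept to match index 0.\<close>
      have "D (n + 1 + int 0) \<le> - \<epsilon>"
      proof (rule \<epsilon>(2)[where x = "\<lambda>k. x (n + 1 + int k)" and s = "\<lambda>k. s (n + 1 + int k)"
            and D = "\<lambda>k. D (n + 1 + int k)"])
        fix k
        show "\<bar>x (n + 1 + int (Suc k)) - (1 - a * \<bar>x (n + 1 + int k)\<bar>)\<bar> \<le> \<epsilon>"
          using x_err[of "n + 1 + int k"] \<epsilon>(1) by (simp add: add_ac)
        show "\<bar>D (n + 1 + int (Suc k)) - (- a * s (n + 1 + int k) * D (n + 1 + int k) -
            \<bar>x (n + 1 + int k)\<bar>)\<bar> \<le> \<epsilon>"
          using D_err[of "n + 1 + int k"] \<epsilon>(1) by (simp add: add_ac)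
      qed (use s sx xK DK near in auto)
      then have Dn: "D (n + 1) \<le> - \<epsilon>" by simp
      have "a * (s n * D n) \<ge> \<epsilon> / 2"
        using D_err[of n] Dn True \<epsilon>(1) unfolding mult_minus_left mult.assoc by linarith
      moreover have "a * (s n * D n) \<le> 2 * (s n * D n)" if "s n * D n \<ge> 0"
        using that a by (intro mult_right_mono) auto
      moreover have "a * (s n * D n) \<le> 0" if "s n * D n < 0"
        using that a by (simp add: mult_nonneg_nonpos)
      ultimately have "s n * D n \<ge> \<epsilon> / 8" using \<epsilon>(1) by (cases "s n * D n \<ge> 0") linarith+
      then have "\<tau> * (s n * D n) \<ge> \<tau> * (\<epsilon> / 8)" using \<tau> by (intro mult_left_mono) auto
      moreover have "s n * y n = \<bar>x n\<bar> + \<tau> * (s n * D n)"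
        unfolding y_eq by (simp add: distrib_left sx mult.left_commute)
      ultimately show ?thesis by linarith
    next
      case False
      have "\<tau> \<le> 2 * ((N + 1) * \<delta>)"
      proof -
        have "N * (t' - t) \<le> (N + 1) * (2 * \<delta>)" using t N by (intro mult_mono) auto
        then show ?thesis by (simp add: \<tau>_def)
      qed
      then have "\<tau> * K \<le> 2 * ((N + 1) * \<delta>) * K" using K by (intro mult_right_mono) auto
      then have "\<tau> * K \<le> \<epsilon> / 16" using \<delta>K by linarith
      moreover have "\<bar>\<tau> * (s n * D n)\<bar> \<le> \<tau> * K"
        using \<tau> DK[of n] s_abs by (simp add: abs_mult)
      moreover have "s n * y n = \<bar>x n\<bar> + \<tau> * (s n * D n)"
        unfolding y_eq by (simp add: distrib_left sx mult.left_commute)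
      ultimately show ?thesis using False by linarith
    qed
    have "bounded_lozi_orbit (a2, b2) y"
    proof (rule signed_solution_lozi_orbit[OF y])
      fix n
      have "0 \<le> min (\<epsilon> / 16) (\<tau> * (\<epsilon> / 8))" using \<epsilon> \<tau> by simp
      with lower[of n] show "0 \<le> s n * y n" by linarith
    qed
    with lower show ?thesis unfolding ab s_def \<tau>_def by blast
  qed
  show ?thesis
  proof (rule that[OF _ \<delta> params])
    show "N > 0" using N by simp
    fix t t' assume t: "\<bar>t\<bar> < \<delta>" "\<bar>t'\<bar> < \<delta>" "t < t'"
    have "min (\<epsilon> / 16) (N * (t' - t) * (\<epsilon> / 8)) > 0" using t N \<epsilon> by simp
    with continuation[OF t] show "\<exists>\<kappa>>0. \<forall>x. bounded_lozi_orbit (a + N * t, \<sigma> * t) x \<longrightarrow>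
         (\<exists>y. bounded_lozi_orbit (a + N * t', \<sigma> * t') y \<and>
              (\<forall>n. (if x n \<ge> 0 then 1 else - 1) * y n \<ge> \<kappa>))" by blast
  qed
qed

section \<open>Comparison of entropies\<close>

text \<open>Surjectivity on C allows a preimage inside C to be chosen at every backward step. The
  past is a choice when f is not injective, as for the Lozi map at b = 0.\<close>

lemma invariant_set_full_orbit:
  assumes inv: "f ` C = C" and u: "u \<in> C"
  shows "\<exists>w :: int \<Rightarrow> 'a. w 0 = u \<and> (\<forall>n. w n \<in> C) \<and> (\<forall>n. w (n + 1) = f (w n))"
proof -
  define g where "g = inv_into C f"
  have g: "g v \<in> C" "f (g v) = v" if "v \<in> C" for v
    using that inv by (auto simp: g_def inv_into_into f_inv_into_f)
  have fC: "(f ^^ k) u \<in> C" for k using u inv by (induction k) auto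
  have gC: "(g ^^ k) u \<in> C" for k using u g(1) by (induction k) auto
  define w where "w = (\<lambda>n :: int. if n \<ge> 0 then (f ^^ nat n) u else (g ^^ nat (- n)) u)"
  show ?thesis
  proof (intro exI[of _ w] conjI allI)
    show "w 0 = u" by (simp add: w_def)
    fix n
    show "w n \<in> C" using fC gC by (simp add: w_def)
    show "w (n + 1) = f (w n)"
    proof (cases "n \<ge> 0")
      case True
      then show ?thesis by (simp add: w_def nat_add_distrib)
    next
      case False
      define k where "k = nat (- n - 1)"
      have n: "n = - int (Suc k)" using False by (simp add: k_def)
      have "nat (- n) = Suc k" by (simp add: n)
      then have "w n = g ((g ^^ k) u)" by (simp add: w_def n)
      moreover have "n + 1 = - int k" by (simp add: n)
      then have "w (n + 1) = (g ^^ k) u" by (cases "k = 0") (simp_all add: w_def)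
      ultimately show ?thesis using g(2)[OF gC] by simp
    qed
  qed
qed

section \<open>Planar Lozi orbits as scalar sequences\<close>

lemma snd_lozi: "snd (lozi p z) = fst z"
  by (cases p; cases z) simp

lemma continuous_on_lozi: "continuous_on S (lozi p)"
proof -
  obtain a b where p: "p = (a, b)" by (cases p)
  have "lozi p = (\<lambda>z. (1 - a * \<bar>fst z\<bar> + b * snd z, fst z))" by (auto simp: p)
  then show ?thesis by (auto intro!: continuous_intros)
qed

lemma lozi_invariant_orbit:
  assumes "compact C" "lozi p ` C = C" "u \<in> C"
  obtains x where "bounded_lozi_orbit p x" "(x 0, x (-1)) = u"
proof -
  obtain w :: "int \<Rightarrow> real \<times> real" where w: "w 0 = u" "\<And>n. w n \<in> C" "\<And>n. w (n + 1) = lozi p (w n)"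
    using invariant_set_full_orbit[OF assms(2,3)] by blast
  define x where "x = (\<lambda>n. fst (w n))"
  have pair: "w n = (x n, x (n - 1))" for n
    using w(3)[of "n - 1"] by (simp add: x_def snd_lozi prod_eq_iff)
  have "bounded (fst ` C)" using assms(1) by (simp add: bounded_fst compact_imp_bounded)
  then have "bounded (range x)" by (rule bounded_subset) (use w(2) in \<open>auto simp: x_def\<close>)
  moreover have "(x (n + 1), x n) = lozi p (x n, x (n - 1))" for n
    using w(3)[of n] unfolding pair[of n] pair[of "n + 1"] by simp
  ultimately have "bounded_lozi_orbit p x" by (simp add: bounded_lozi_orbit_def)
  moreover have "(x 0, x (-1)) = u" using pair[of 0] w(1) by simp
  ultimately show ?thesis by (rule that)
qed

lemma bounded_lozi_orbit_shift:
  assumes "bounded_lozi_orbit p x"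
  shows "bounded_lozi_orbit p (\<lambda>n. x (n + m))"
proof -
  have "bounded (range (\<lambda>n. x (n + m)))"
    using assms by (auto simp: bounded_lozi_orbit_def intro: bounded_subset)
  moreover have "(x (n + 1 + m), x (n + m)) = lozi p (x (n + m), x (n - 1 + m))" for n
  proof -
    have "(x (n + m + 1), x (n + m)) = lozi p (x (n + m), x (n + m - 1))"
      using assms by (simp add: bounded_lozi_orbit_def)
    moreover have "n + m + 1 = n + 1 + m" "n + m - 1 = n - 1 + m" by simp_all
    ultimately show ?thesis by metis
  qed
  ultimately show ?thesis unfolding bounded_lozi_orbit_def by blast
qed

lemma lozi_funpow_orbit:
  assumes "bounded_lozi_orbit p x"
  shows "(lozi p ^^ i) (x n, x (n - 1)) = (x (n + int i), x (n + int i - 1))"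
proof (induction i)
  case (Suc i)
  have "lozi p (x (n + int i), x (n + int i - 1)) = (x (n + int i + 1), x (n + int i))"
    using assms by (simp add: bounded_lozi_orbit_def)
  then show ?case using Suc by (simp add: add_ac)
qed simp

section \<open>The invariant set of points on bounded orbits\<close>

definition bounded_orbit_points :: "real \<times> real \<Rightarrow> (real \<times> real) set" where
  "bounded_orbit_points p = {(x 0, x (-1)) |x. bounded_lozi_orbit p x}"

lemma bounded_orbit_points_memI:
  assumes "bounded_lozi_orbit p x"
  shows "(x n, x (n - 1)) \<in> bounded_orbit_points p"
proof -
  show ?thesis
    using bounded_lozi_orbit_shift[OF assms, of n] unfolding bounded_orbit_points_def
    by (intro CollectI exI[of _ "\<lambda>m. x (m + n)"]) simp
qed

lemma lozi_bounded_orbit_points: "lozi p ` bounded_orbit_points p = bounded_orbit_points p"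
proof (intro equalityI subsetI)
  fix v assume "v \<in> lozi p ` bounded_orbit_points p"
  then obtain x where x: "bounded_lozi_orbit p x" "v = lozi p (x 0, x (-1))"
    by (auto simp: bounded_orbit_points_def)
  then have "v = (x 1, x 0)" using lozi_funpow_orbit[OF x(1), of 1 0] by simp
  then show "v \<in> bounded_orbit_points p" using bounded_orbit_points_memI[OF x(1), of 1] by simp
next
  fix v assume "v \<in> bounded_orbit_points p"
  then obtain x where x: "bounded_lozi_orbit p x" "v = (x 0, x (-1))"
    by (auto simp: bounded_orbit_points_def)
  then have "v = lozi p (x (-1), x (-1 - 1))" using lozi_funpow_orbit[OF x(1), of 1 "-1"] by simp
  then show "v \<in> lozi p ` bounded_orbit_points p"
    using bounded_orbit_points_memI[OF x(1)] by blast
qed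

lemma bounded_bounded_orbit_points:
  assumes "a > 1 + \<bar>b\<bar>"
  shows "bounded (bounded_orbit_points (a, b))"
proof (rule bounded_subset)
  define M where "M = 1 / (a - 1 - \<bar>b\<bar>)"
  show "bounded ({-M..M} \<times> {-M..M})" by (intro bounded_Times bounded_closed_interval)
  have "\<bar>x n\<bar> \<le> M" if "bounded_lozi_orbit (a, b) x" for x n
    unfolding M_def by (rule signed_solution_bound[OF assms lozi_orbit_signed_solution[OF that]])
  then show "bounded_orbit_points (a, b) \<subseteq> {-M..M} \<times> {-M..M}"
    by (auto simp: bounded_orbit_points_def abs_le_iff minus_le_iff)
qed

text \<open>Passing to the closure turns boundedness into compactness. Invariance survives: one
  inclusion by continuity, the other because the image of the compact closure is closed and contains
  the original set.\<close>

lemma closure_bounded_orbit_points: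
  assumes "a > 1 + \<bar>b\<bar>"
  shows "compact (closure (bounded_orbit_points (a, b)))"
    and "lozi (a, b) ` closure (bounded_orbit_points (a, b)) = closure (bounded_orbit_points (a, b))"
proof -
  let ?A = "bounded_orbit_points (a, b)"
  show compact: "compact (closure ?A)"
    using bounded_bounded_orbit_points[OF assms] by simp
  show "lozi (a, b) ` closure ?A = closure ?A"
  proof
    show "lozi (a, b) ` closure ?A \<subseteq> closure ?A"
      by (rule image_closure_subset[OF continuous_on_lozi])
        (use lozi_bounded_orbit_points[of "(a, b)"] closure_subset[of ?A] in auto)
    have "closed (lozi (a, b) ` closure ?A)"
      by (intro compact_imp_closed compact_continuous_image continuous_on_lozi compact)
    moreover have "?A \<subseteq> lozi (a, b) ` closure ?A"
      using lozi_bounded_orbit_points[of "(a, b)"] closure_subset[of ?A] by blast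
    ultimately show "closure ?A \<subseteq> lozi (a, b) ` closure ?A" by (rule closure_minimal[rotated])
  qed
qed

section \<open>Growth rates of separated sets\<close>

lemma limsup_growth_shift:
  fixes u v :: "nat \<Rightarrow> ereal"
  assumes le: "\<And>n. u n \<le> v (n + K)"
  shows "limsup (\<lambda>n. u n / ereal (real n)) \<le> limsup (\<lambda>n. v n / ereal (real n))"
proof (rule dense_ge)
  \<comment> \<open>Two intermediate reals c' < c are inserted: c' eventually bounds the growth of
    v, and c - c' absorbs the term c' * K / n caused by the shift.\<close>
  fix z assume "limsup (\<lambda>n. v n / ereal (real n)) < z"
  then obtain c where c: "limsup (\<lambda>n. v n / ereal (real n)) < ereal c" "ereal c < z"
    using ereal_dense2 by blast
  then obtain c' where c': "limsup (\<lambda>n. v n / ereal (real n)) < ereal c'" "ereal c' < ereal c"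
    using ereal_dense2 by blast
  have "\<forall>\<^sub>F n in sequentially. v n / ereal (real n) < ereal c'"
    using c'(1) by (rule Limsup_lessD)
  then have "\<forall>\<^sub>F n in sequentially. v (n + K) / ereal (real (n + K)) < ereal c'"
    by (rule sequentially_offset)
  moreover have "(\<lambda>n. c' + c' * real K / real n) \<longlonglongrightarrow> c' + 0"
    by (intro tendsto_intros lim_const_over_n)
  then have "\<forall>\<^sub>F n in sequentially. c' + c' * real K / real n < c"
    by (rule order_tendstoD) (use c'(2) in simp)
  moreover have "\<forall>\<^sub>F n in sequentially. n > 0" by (rule eventually_gt_at_top)
  ultimately have "\<forall>\<^sub>F n in sequentially. u n / ereal (real n) \<le> ereal c"
  proof eventually_elim
    case (elim n)
    have "v (n + K) \<le> ereal (c' * real (n + K))"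
      using elim(1,3) by (cases "v (n + K)") (auto simp: field_simps)
    then have "u n \<le> ereal (c' * real (n + K))" using le[of n] by (rule order_trans[rotated])
    then have "u n / ereal (real n) \<le> ereal (c' + c' * real K / real n)"
      using elim(3) by (cases "u n") (auto simp: field_simps)
    also have "\<dots> \<le> ereal c" using elim(2) by simp
    finally show ?case .
  qed
  then have "limsup (\<lambda>n. u n / ereal (real n)) \<le> ereal c" by (rule Limsup_bounded)
  then show "limsup (\<lambda>n. u n / ereal (real n)) \<le> z" using c(2) by (meson less_imp_le order_trans)
qed

lemma log_max_separated_le:
  assumes "\<And>E. \<lbrakk>E \<subseteq> C; finite E; separated_orbits f n \<epsilon> E\<rbrakk> \<Longrightarrow>
      \<exists>\<phi>. inj_on \<phi> E \<and> \<phi> ` E \<subseteq> C' \<and> separated_orbits f' n' \<epsilon>' (\<phi> ` E)"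
  shows "log_max_separated f C n \<epsilon> \<le> log_max_separated f' C' n' \<epsilon>'"
  unfolding log_max_separated_def
proof (rule SUP_mono)
  fix E assume "E \<in> {E. E \<subseteq> C \<and> finite E \<and> separated_orbits f n \<epsilon> E}"
  then have E: "E \<subseteq> C" "finite E" "separated_orbits f n \<epsilon> E" by auto
  then obtain \<phi> where \<phi>: "inj_on \<phi> E" "\<phi> ` E \<subseteq> C'" "separated_orbits f' n' \<epsilon>' (\<phi> ` E)"
    using assms by blast
  show "\<exists>E'\<in>{E. E \<subseteq> C' \<and> finite E \<and> separated_orbits f' n' \<epsilon>' E}.
      ereal (ln (real (card E))) \<le> ereal (ln (real (card E')))"
    by (rule bexI[of _ "\<phi> ` E"]) (use E \<phi> in \<open>auto simp: card_image\<close>)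
qed

text \<open>Continuing orbits carries every separated set of C injectively to one for p. The new
  scale \<kappa> is the same for all n, and time grows only by a constant depending on \<epsilon>,
  which leaves the exponential growth rate unaffected.\<close>

lemma entropy_on_le_of_sign_separated:
  fixes a b :: real
  assumes ab: "a > 1 + \<bar>b\<bar>" and C: "compact C" "lozi (a, b) ` C = C" and \<kappa>: "\<kappa> > 0"
    and continuation: "\<And>x. bounded_lozi_orbit (a, b) x \<Longrightarrow>
       \<exists>y. bounded_lozi_orbit p y \<and> (\<forall>n. (if x n \<ge> 0 then 1 else - 1) * y n \<ge> \<kappa>)"
  shows "entropy_on (lozi (a, b)) C \<le> entropy_on (lozi p) (closure (bounded_orbit_points p))"
  unfolding entropy_on_def
proof (rule SUP_least)
  fix \<epsilon> :: real assume "\<epsilon> \<in> {0<..}"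
  then have \<epsilon>: "\<epsilon> > 0" by simp
  let ?C' = "closure (bounded_orbit_points p)"
  let ?s = "\<lambda>x :: int \<Rightarrow> real. \<lambda>n. if x n \<ge> 0 then 1 else (- 1 :: real)"
  define M where "M = 2 / (a - 1 - \<bar>b\<bar>)"
  have M: "M > 0" using ab by (simp add: M_def)
  have "(1 + \<bar>b\<bar>) / a < 1" using ab by simp
  \<comment> \<open>The window radius k is such that equal signs force coordinates to within
    \<epsilon> / 2. The half is there because the distance of two pairs is at most the sum of their
    two coordinate differences.\<close>
  then obtain k where k: "((1 + \<bar>b\<bar>) / a) ^ k < \<epsilon> / 2 / M"
    using real_arch_pow_inv[of "\<epsilon> / 2 / M"] \<epsilon> M by auto
  then have k: "M * ((1 + \<bar>b\<bar>) / a) ^ k < \<epsilon> / 2" using M by (simp add: field_simps)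
  have signs_differ: "\<exists>j. \<bar>j - m\<bar> \<le> int k \<and> ?s x j \<noteq> ?s x' j"
    if "bounded_lozi_orbit (a, b) x" "bounded_lozi_orbit (a, b) x'" "\<bar>x m - x' m\<bar> \<ge> \<epsilon> / 2" for x x' m
  proof (rule ccontr)
    assume "\<not> ?thesis"
    then have "\<bar>x m - x' m\<bar> \<le> M * ((1 + \<bar>b\<bar>) / a) ^ k"
      unfolding M_def
      by (intro signed_solutions_close[OF ab lozi_orbit_signed_solution[OF that(1)]
            lozi_orbit_signed_solution[OF that(2)]]) blast
    with k that(3) show False by linarith
  qed
  have "\<exists>x. bounded_lozi_orbit (a, b) x \<and> (x 0, x (-1)) = u" if "u \<in> C" for u
    using lozi_invariant_orbit[OF C that] by metis
  then obtain X where X: "\<And>u. u \<in> C \<Longrightarrow> bounded_lozi_orbit (a, b) (X u)"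
    "\<And>u. u \<in> C \<Longrightarrow> (X u 0, X u (-1)) = u" by metis
  obtain Y where Y: "\<And>u. u \<in> C \<Longrightarrow> bounded_lozi_orbit p (Y u)"
    "\<And>u n. u \<in> C \<Longrightarrow> ?s (X u) n * Y u n \<ge> \<kappa>"
    using continuation[OF X(1)] by metis
  \<comment> \<open>The starting index is moved back by \<open>k + 1\<close> because closeness in \<open>C\<close> depends on the past signs
    as well, and for \<open>b = 0\<close> these cannot be recovered from a point of the other system.\<close>
  define m where "m = - int k - 1"
  define \<phi> where "\<phi> = (\<lambda>u. (Y u m, Y u (m - 1)))"
  have \<phi>: "\<exists>i<n + (2 * k + 2). \<kappa> < dist ((lozi p ^^ i) (\<phi> u)) ((lozi p ^^ i) (\<phi> v))"
    if uv: "u \<in> C" "v \<in> C" and i: "i < n" "\<epsilon> < dist ((lozi (a, b) ^^ i) u) ((lozi (a, b) ^^ i) v)" for u v i n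
  proof -
    have orbit: "(lozi (a, b) ^^ i) w = (X w (int i), X w (int i - 1))" if "w \<in> C" for w
      using lozi_funpow_orbit[OF X(1)[OF that], of i 0] X(2)[OF that] by simp
    have "\<epsilon> < \<bar>X u (int i) - X v (int i)\<bar> + \<bar>X u (int i - 1) - X v (int i - 1)\<bar>"
      using i(2) sqrt_sum_squares_le_sum_abs[of "X u (int i) - X v (int i)" "X u (int i - 1) - X v (int i - 1)"]
      unfolding orbit[OF uv(1)] orbit[OF uv(2)] dist_Pair_Pair dist_real_def by simp
    then have "\<bar>X u (int i) - X v (int i)\<bar> \<ge> \<epsilon> / 2 \<or> \<bar>X u (int i - 1) - X v (int i - 1)\<bar> \<ge> \<epsilon> / 2"
      by linarith
    then obtain l where l: "l = int i \<or> l = int i - 1" "\<bar>X u l - X v l\<bar> \<ge> \<epsilon> / 2" by blast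
    obtain j where j: "\<bar>j - l\<bar> \<le> int k" "?s (X u) j \<noteq> ?s (X v) j"
      using signs_differ[OF X(1)[OF uv(1)] X(1)[OF uv(2)] l(2)] by blast
    have Y_dist: "\<kappa> < \<bar>Y u j - Y v j\<bar>"
      using Y(2)[OF uv(1), of j] Y(2)[OF uv(2), of j] j(2) \<kappa> by (auto split: if_splits)
    define i' where "i' = nat (j - m)"
    \<comment> \<open>Since l ranges from -1 to n - 1, j lies between -k - 1 = m and n - 1 + k, so j
      - m is between 0 and n + 2 * k.\<close>
    have i': "m + int i' = j" "i' < n + (2 * k + 2)"
      using l(1) j(1) i(1) by (auto simp: i'_def m_def)
    have "(lozi p ^^ i') (\<phi> w) = (Y w j, Y w (j - 1))" if "w \<in> C" for w
      unfolding \<phi>_def lozi_funpow_orbit[OF Y(1)[OF that]] i' ..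
    then have "dist ((lozi p ^^ i') (\<phi> u)) ((lozi p ^^ i') (\<phi> v)) \<ge> \<bar>Y u j - Y v j\<bar>"
      using uv by (simp add: dist_Pair_Pair dist_real_def)
    with Y_dist i'(2) show ?thesis by (meson less_le_trans)
  qed
  have "log_max_separated (lozi (a, b)) C n \<epsilon> \<le> log_max_separated (lozi p) ?C' (n + (2 * k + 2)) \<kappa>" for n
  proof (rule log_max_separated_le)
    fix E assume E: "E \<subseteq> C" "separated_orbits (lozi (a, b)) n \<epsilon> E"
    have sep: "\<exists>i<n + (2 * k + 2). \<kappa> < dist ((lozi p ^^ i) (\<phi> u)) ((lozi p ^^ i) (\<phi> v))"
      if "u \<in> E" "v \<in> E" "u \<noteq> v" for u v
      using E that \<phi>[of u v] unfolding separated_orbits_def by blast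
    have "inj_on \<phi> E"
    proof (rule inj_onI, rule ccontr)
      fix u v assume "u \<in> E" "v \<in> E" "\<phi> u = \<phi> v" "u \<noteq> v"
      with sep[of u v] \<kappa> show False by simp
    qed
    moreover have "\<phi> ` E \<subseteq> ?C'"
      using E(1) bounded_orbit_points_memI[OF Y(1)] closure_subset by (fastforce simp: \<phi>_def)
    moreover have "separated_orbits (lozi p) (n + (2 * k + 2)) \<kappa> (\<phi> ` E)"
      using sep unfolding separated_orbits_def by blast
    ultimately show "\<exists>\<phi>. inj_on \<phi> E \<and> \<phi> ` E \<subseteq> ?C' \<and>
        separated_orbits (lozi p) (n + (2 * k + 2)) \<kappa> (\<phi> ` E)" by blast
  qed
  then have "limsup (\<lambda>n. log_max_separated (lozi (a, b)) C n \<epsilon> / ereal (real n))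
      \<le> limsup (\<lambda>n. log_max_separated (lozi p) ?C' n \<kappa> / ereal (real n))"
    by (rule limsup_growth_shift)
  also have "\<dots> \<le> (SUP \<epsilon>\<in>{0<..}. limsup (\<lambda>n. log_max_separated (lozi p) ?C' n \<epsilon> / ereal (real n)))"
    by (rule SUP_upper) (use \<kappa> in simp)
  finally show "limsup (\<lambda>n. log_max_separated (lozi (a, b)) C n \<epsilon> / ereal (real n))
      \<le> (SUP \<epsilon>\<in>{0<..}. limsup (\<lambda>n. log_max_separated (lozi p) ?C' n \<epsilon> / ereal (real n)))" .
qed

text \<open>All compact invariant sets of the first map are compared with one set of the second, the
  closure of its bounded orbit points, which is nonempty as soon as one orbit continues. The case z
  = 0 is the default value inserted in \<open>h_top\<close>.\<close>

lemma h_top_lozi_le: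
  assumes ab: "a > 1 + \<bar>b\<bar>" and ab': "a' > 1 + \<bar>b'\<bar>" and \<kappa>: "\<kappa> > 0"
    and continuation: "\<And>x. bounded_lozi_orbit (a, b) x \<Longrightarrow>
       \<exists>y. bounded_lozi_orbit (a', b') y \<and> (\<forall>n. (if x n \<ge> 0 then 1 else - 1) * y n \<ge> \<kappa>)"
  shows "h_top (lozi (a, b)) \<le> h_top (lozi (a', b'))"
  unfolding h_top_def[of "lozi (a, b)"]
proof (rule Sup_least, elim insertE CollectE exE conjE)
  fix z :: ereal assume "z = 0"
  then show "z \<le> h_top (lozi (a', b'))" unfolding h_top_def by (auto intro: Sup_upper)
next
  fix z C assume z: "z = entropy_on (lozi (a, b)) C"
    and C: "compact C" "C \<noteq> {}" "lozi (a, b) ` C = C"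
  let ?C' = "closure (bounded_orbit_points (a', b'))"
  obtain u where "u \<in> C" using C(2) by blast
  then obtain x where "bounded_lozi_orbit (a, b) x" using lozi_invariant_orbit[OF C(1,3)] by metis
  then obtain y where "bounded_lozi_orbit (a', b') y" using continuation by blast
  then have "?C' \<noteq> {}" using bounded_orbit_points_memI by fastforce
  then have "entropy_on (lozi (a', b')) ?C' \<le> h_top (lozi (a', b'))"
    unfolding h_top_def using closure_bounded_orbit_points[OF ab'] by (intro Sup_upper) blast
  with entropy_on_le_of_sign_separated[OF ab C(1,3) \<kappa> continuation]
  show "z \<le> h_top (lozi (a', b'))" unfolding z by (rule order_trans)
qed

text \<open>The sign \<sigma> treats both lines at once: -1 gives the first and 1 the
  second.\<close>

lemma lozi_line_h_top_mono:
  fixes a \<sigma> :: real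
  assumes a: "1 < a" "a \<le> 2" and \<sigma>: "\<bar>\<sigma>\<bar> = 1"
  shows "\<exists>N \<delta>. N > 0 \<and> \<delta> > 0 \<and> (\<lambda>t. (a + N * t, \<sigma> * t)) ` {-\<delta><..<\<delta>} \<subseteq> lozi_params \<and>
    mono_on {-\<delta><..<\<delta>} (\<lambda>t. h_top (lozi (a + N * t, \<sigma> * t)))"
proof -
  obtain N \<delta> where N: "N > 0" and \<delta>: "\<delta> > 0"
    and params: "\<And>t. \<bar>t\<bar> < \<delta> \<Longrightarrow> a + N * t > 1 + \<bar>\<sigma> * t\<bar>"
    and cont: "\<And>t t'. \<lbrakk>\<bar>t\<bar> < \<delta>; \<bar>t'\<bar> < \<delta>; t < t'\<rbrakk> \<Longrightarrow>
       \<exists>\<kappa>>0. \<forall>x. bounded_lozi_orbit (a + N * t, \<sigma> * t) x \<longrightarrow>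
         (\<exists>y. bounded_lozi_orbit (a + N * t', \<sigma> * t') y \<and>
              (\<forall>n. (if x n \<ge> 0 then 1 else - 1) * y n \<ge> \<kappa>))"
    by (rule lozi_line_continuation[OF a \<sigma>]) (rule that)
  have "mono_on {-\<delta><..<\<delta>} (\<lambda>t. h_top (lozi (a + N * t, \<sigma> * t)))"
  proof (rule mono_onI)
    fix t t' assume "t \<in> {-\<delta><..<\<delta>}" "t' \<in> {-\<delta><..<\<delta>}" "t \<le> t'"
    then have t: "\<bar>t\<bar> < \<delta>" "\<bar>t'\<bar> < \<delta>" "t < t' \<or> t = t'" by auto
    show "h_top (lozi (a + N * t, \<sigma> * t)) \<le> h_top (lozi (a + N * t', \<sigma> * t'))"
    proof (cases "t = t'")
      case False
      then obtain \<kappa> where "\<kappa> > 0" and \<kappa>: "\<And>x. bounded_lozi_orbit (a + N * t, \<sigma> * t) x \<Longrightarrow>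
         \<exists>y. bounded_lozi_orbit (a + N * t', \<sigma> * t') y \<and>
              (\<forall>n. (if x n \<ge> 0 then 1 else - 1) * y n \<ge> \<kappa>)"
        using cont[OF t(1,2)] t(3) by blast
      then show ?thesis by (intro h_top_lozi_le[OF params[OF t(1)] params[OF t(2)]])
    qed simp
  qed
  with N \<delta> params show ?thesis
    by (intro exI[of _ N] exI[of _ \<delta>]) (auto simp: lozi_params_def)
qed

theorem theorem1p3:
  fixes a :: real
  assumes "1 < a" and "a \<le> 2"
  shows "\<exists>N1 N2 \<delta>1 \<delta>2 :: real. N1 > 0 \<and> N2 > 0 \<and> \<delta>1 > 0 \<and> \<delta>2 > 0 \<and>
    (let \<gamma>1 = (\<lambda>t::real. (a + N1 * t, - t));
         \<gamma>2 = (\<lambda>t::real. (a + N2 * t, t))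
     in \<gamma>1 ` {-\<delta>1<..<\<delta>1} \<subseteq> lozi_params \<and>
        \<gamma>2 ` {-\<delta>2<..<\<delta>2} \<subseteq> lozi_params \<and>
        mono_on {-\<delta>1<..<\<delta>1} (\<lambda>t. h_top (lozi (\<gamma>1 t))) \<and>
        mono_on {-\<delta>2<..<\<delta>2} (\<lambda>t. h_top (lozi (\<gamma>2 t))))"
proof -
  obtain N1 \<delta>1 where 1: "N1 > 0" "\<delta>1 > 0"
    "(\<lambda>t. (a + N1 * t, - 1 * t)) ` {-\<delta>1<..<\<delta>1} \<subseteq> lozi_params"
    "mono_on {-\<delta>1<..<\<delta>1} (\<lambda>t. h_top (lozi (a + N1 * t, - 1 * t)))"
    using lozi_line_h_top_mono[OF assms, of "- 1"] by auto
  obtain N2 \<delta>2 where 2: "N2 > 0" "\<delta>2 > 0"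
    "(\<lambda>t. (a + N2 * t, 1 * t)) ` {-\<delta>2<..<\<delta>2} \<subseteq> lozi_params"
    "mono_on {-\<delta>2<..<\<delta>2} (\<lambda>t. h_top (lozi (a + N2 * t, 1 * t)))"
    using lozi_line_h_top_mono[OF assms, of 1] by auto
  show ?thesis
    unfolding Let_def using 1 2
    by (intro exI[of _ N1] exI[of _ N2] exI[of _ \<delta>1] exI[of _ \<delta>2]) simp
qed

end
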